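(* Let $\mathcal E$ be a super-linear expectation, and let $\mu,\nu$ be compactly supported Borel probability measures on $\mathbb R$. For any cost function $c:\mathbb R^2\to\mathbb R$, weak duality holds: $$\inf_{X\sim\mu,\;Y\sim\nu}\mathcal E[c(X,Y)]\ \ge\ \sup_{(\phi,\psi)\in S_c}\left\{\mathcal E[\phi(X^\mu)]+\mathcal E[\psi(X^\nu)]\right\}.$$ If moreover $c$ is affine (i.e., $c(x,y)=\alpha+\beta x+\gamma y$ for some $\alpha,\beta,\gamma\in\mathbb R$) and $\mathcal E=\mathcal E^h$ for some distortion function $h$, then strong duality holds: $$\inf_{X\sim\mu,\;Y\sim\nu}\mathcal E^h[c(X,Y)]=\sup_{(\phi,\psi)\in S_c}\left\{\mathcal E^h[\phi(X^\mu)]+\mathcal E^h[\psi(X^\nu)]\right\}.$$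
   Context: Fix an atomless probability space $(\Omega,\mathcal A,\mathbb P)$ and let $\mathcal X$ be the set of bounded random variables on it; (in)equalities between random variables are almost sure. $X\sim\mu$ means that $X$ has law $\mu$ under $\mathbb P$. A super-linear expectation is a map $\mathcal E:\mathcal X\to\mathbb R$ satisfying: $\mathcal E[X]\le\mathcal E[Y]$ if $X\le Y$; $\mathcal E[a]=a$ for constants $a\in\mathbb R$; $\mathcal E[X]=\mathcal E[Y]$ if $X,Y$ have the same law; $\mathcal E[X+Y]\ge\mathcal E[X]+\mathcal E[Y]$ for all $X,Y\in\mathcal X$; and $\mathcal E[\lambda X]=\lambda\mathcal E[X]$ for all $\lambda\ge0$, $X\in\mathcal X$. A distortion function is an increasing (non-strictly) function $h:[0,1]\to[0,1]$ with $h(0)=0$ and $h(1)=1$. The associated distorted expectation $\mathcal E^h:\mathcal X\to\mathbb R$ is $$\mathcal E^h[X]=\int_0^\infty h(\mathbb P(X>x))\,\mathrm dx+\int_{-\infty}^0\big(h(\mathbb P(X>x))-1\big)\,\mathrm dx.$$ The cost function $c:\mathbb R^2\to\mathbb R$ is Borel measurable and such that $c(X,Y)\in\mathcal X$ whenever $X\sim\mu$, $Y\sim\nu$. The infima are over all pairs of random variables $(X,Y)$ on $(\Omega,\mathcal A,\mathbb P)$ with $X\sim\mu$, $Y\sim\nu$. $X^\mu$ (resp. $X^\nu$) denotes any random variable with law $\mu$ (resp. $\nu$). $S_c$ is the set of pairs $(\phi,\psi)$ of Borel functions $\phi,\psi:\mathbb R\to\mathbb R$, with $\phi(X^\mu),\psi(X^\nu)\in\mathcal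 X$, such that $\phi(x)+\psi(y)\le c(x,y)$ for all $x,y\in\mathbb R$. The supremum over the empty set is $-\infty$. *)

theory Defs
  imports "HOL-Probability.Probability"
begin

definition atomless :: "'a measure \<Rightarrow> bool" where
  "atomless M \<longleftrightarrow>
     \<not> (\<exists>A\<in>sets M. emeasure M A > 0 \<and>
          (\<forall>B\<in>sets M. B \<subseteq> A \<longrightarrow> emeasure M B = 0 \<or> emeasure M B = emeasure M A))"

text \<open>Since (in)equalities between random variables are almost sure, boundedness is
  essential boundedness: a variable with a compactly supported law need not be bounded
  on a null set.\<close>

definition bounded_rvs :: "'a measure \<Rightarrow> ('a \<Rightarrow> real) set" where
  "bounded_rvs M = {X \<in> borel_measurable M. \<exists>C. AE \<omega> in M. \<bar>X \<omega>\<bar> \<le> C}"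

definition has_law :: "'a measure \<Rightarrow> ('a \<Rightarrow> real) \<Rightarrow> real measure \<Rightarrow> bool" where
  "has_law M X \<mu> \<longleftrightarrow> X \<in> borel_measurable M \<and> distr M borel X = \<mu>"

definition measure_support :: "real measure \<Rightarrow> real set" where
  "measure_support \<mu> = {x. \<forall>U. open U \<longrightarrow> x \<in> U \<longrightarrow> emeasure \<mu> U > 0}"

definition super_linear_expectation :: "'a measure \<Rightarrow> (('a \<Rightarrow> real) \<Rightarrow> real) \<Rightarrow> bool" where
  "super_linear_expectation M \<E> \<longleftrightarrow>
     (\<forall>X\<in>bounded_rvs M. \<forall>Y\<in>bounded_rvs M. (AE \<omega> in M. X \<omega> \<le> Y \<omega>) \<longrightarrow> \<E> X \<le> \<E> Y) \<and>
     (\<forall>a. \<E> (\<lambda>\<omega>. a) = a) \<and>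
     (\<forall>X\<in>bounded_rvs M. \<forall>Y\<in>bounded_rvs M. distr M borel X = distr M borel Y \<longrightarrow> \<E> X = \<E> Y) \<and>
     (\<forall>X\<in>bounded_rvs M. \<forall>Y\<in>bounded_rvs M. \<E> (\<lambda>\<omega>. X \<omega> + Y \<omega>) \<ge> \<E> X + \<E> Y) \<and>
     (\<forall>l\<ge>0. \<forall>X\<in>bounded_rvs M. \<E> (\<lambda>\<omega>. l * X \<omega>) = l * \<E> X)"

text \<open>Distortion functions are only constrained on the unit interval; their values
  elsewhere are never used.\<close>

definition distortion_function :: "(real \<Rightarrow> real) \<Rightarrow> bool" where
  "distortion_function h \<longleftrightarrow>
     h \<in> {0..1} \<rightarrow> {0..1} \<and> mono_on {0..1} h \<and> h 0 = 0 \<and> h 1 = 1"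

definition distorted_expectation :: "'a measure \<Rightarrow> (real \<Rightarrow> real) \<Rightarrow> ('a \<Rightarrow> real) \<Rightarrow> real" where
  "distorted_expectation M h X =
     (LINT x:{0..}|lborel. h (measure M {\<omega>\<in>space M. X \<omega> > x})) +
     (LINT x:{..0}|lborel. h (measure M {\<omega>\<in>space M. X \<omega> > x}) - 1)"

definition couplings ::
    "'a measure \<Rightarrow> real measure \<Rightarrow> real measure \<Rightarrow> (('a \<Rightarrow> real) \<times> ('a \<Rightarrow> real)) set" where
  "couplings M \<mu> \<nu> = {(X, Y). has_law M X \<mu> \<and> has_law M Y \<nu>}"

definition cost_function ::
    "'a measure \<Rightarrow> real measure \<Rightarrow> real measure \<Rightarrow> (real \<times> real \<Rightarrow> real) \<Rightarrow> bool" where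
  "cost_function M \<mu> \<nu> c \<longleftrightarrow>
     c \<in> borel_measurable borel \<and>
     (\<forall>(X, Y)\<in>couplings M \<mu> \<nu>. (\<lambda>\<omega>. c (X \<omega>, Y \<omega>)) \<in> bounded_rvs M)"

text \<open>The variables \<open>X\<close> and \<open>Y\<close> only enter through their laws, as membership in
  \<open>bounded_rvs M\<close> is law-invariant.\<close>

definition dual_pairs ::
    "'a measure \<Rightarrow> ('a \<Rightarrow> real) \<Rightarrow> ('a \<Rightarrow> real) \<Rightarrow> (real \<times> real \<Rightarrow> real)
      \<Rightarrow> ((real \<Rightarrow> real) \<times> (real \<Rightarrow> real)) set" where
  "dual_pairs M X Y c =
     {(\<phi>, \<psi>). \<phi> \<in> borel_measurable borel \<and> \<psi> \<in> borel_measurable borel \<and>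
        (\<lambda>\<omega>. \<phi> (X \<omega>)) \<in> bounded_rvs M \<and> (\<lambda>\<omega>. \<psi> (Y \<omega>)) \<in> bounded_rvs M \<and>
        (\<forall>x y. \<phi> x + \<psi> y \<le> c (x, y))}"

text \<open>The two sides of the duality are taken in the extended reals, where the supremum over
  the empty set is \<open>- \<infinity>\<close>.\<close>

definition primal_value ::
    "'a measure \<Rightarrow> (('a \<Rightarrow> real) \<Rightarrow> real) \<Rightarrow> real measure \<Rightarrow> real measure
      \<Rightarrow> (real \<times> real \<Rightarrow> real) \<Rightarrow> ereal" where
  "primal_value M \<E> \<mu> \<nu> c =
     (INF (X, Y)\<in>couplings M \<mu> \<nu>. ereal (\<E> (\<lambda>\<omega>. c (X \<omega>, Y \<omega>))))"

definition dual_value ::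
    "'a measure \<Rightarrow> (('a \<Rightarrow> real) \<Rightarrow> real) \<Rightarrow> ('a \<Rightarrow> real) \<Rightarrow> ('a \<Rightarrow> real)
      \<Rightarrow> (real \<times> real \<Rightarrow> real) \<Rightarrow> ereal" where
  "dual_value M \<E> X Y c =
     (SUP (\<phi>, \<psi>)\<in>dual_pairs M X Y c. ereal (\<E> (\<lambda>\<omega>. \<phi> (X \<omega>)) + \<E> (\<lambda>\<omega>. \<psi> (Y \<omega>))))"

end

(* Weak duality: for a coupling (X, Y), monotonicity and superadditivity give
   E[c(X, Y)] >= E[phi(X) + psi(Y)] >= E[phi(X)] + E[psi(Y)].
   For c(x, y) = alpha + beta x + gamma y the pair (alpha + beta x, gamma y) is dual feasible, so
   the gap closes as soon as some coupling satisfies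
   E^h[beta X + gamma Y] <= E^h[beta X] + E^h[gamma Y]. This holds when beta X and gamma Y are
   nondecreasing functions of one uniform variable U, because a distorted expectation is additive
   on sums of indicators of nested events, and the level sets of two comonotone variables are
   nested. The variable U exists since M is atomless: halving events repeatedly yields an
   increasing family of events of every dyadic probability. *)

theory Submission
  imports Defs
begin

section \<open>Uniform random variables on atomless spaces\<close>

lemma (in prob_space) atomless_half_subset:
  assumes "atomless M" "A \<in> sets M" "0 < prob A"
  shows "\<exists>B\<in>sets M. B \<subseteq> A \<and> 0 < prob B \<and> prob B \<le> prob A / 2"
proof -
  have "emeasure M A > 0"
    using assms(3) by (simp add: emeasure_eq_measure)
  then have "\<not> (\<forall>B\<in>sets M. B \<subseteq> A \<longrightarrow> emeasure M B = 0 \<or> emeasure M B = emeasure M A)"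
    using assms(1,2) unfolding atomless_def by blast
  then obtain B where B: "B \<in> sets M" "B \<subseteq> A" "prob B \<noteq> 0" "prob B \<noteq> prob A"
    by (auto simp: emeasure_eq_measure)
  have diff: "prob (A - B) = prob A - prob B"
    using B assms(2) by (intro finite_measure_Diff) auto
  have le: "prob B \<le> prob A"
    using B assms(2) by (intro finite_measure_mono) auto
  have pos: "0 < prob B"
    using B(3) by (simp add: zero_less_measure_iff)
  \<comment> \<open>\<open>B\<close> and \<open>A - B\<close> both have positive probability, and
    the two probabilities add up to \<open>prob A\<close>, so one of them is at most half of
    it.\<close>
  show ?thesis
  proof (cases "prob B \<le> prob A / 2")
    case True
    with B pos show ?thesis by blast
  next
    case False
    with B le diff assms(2) show ?thesis by (intro bexI[of _ "A - B"]) auto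
  qed
qed

text \<open>Halving \<open>n\<close> times leaves an event of positive probability at most
  \<open>prob A / 2 ^ n\<close>, which drops below \<open>e\<close> for large
  \<open>n\<close>.\<close>

lemma (in prob_space) atomless_small_subset:
  assumes "atomless M" "A \<in> sets M" "0 < prob A" "0 < e"
  shows "\<exists>B\<in>sets M. B \<subseteq> A \<and> 0 < prob B \<and> prob B \<le> e"
proof -
  have *: "\<exists>B\<in>sets M. B \<subseteq> A \<and> 0 < prob B \<and> prob B \<le> prob A / 2 ^ n" for n
  proof (induction n)
    case 0
    then show ?case using assms by auto
  next
    case (Suc n)
    then obtain B where B: "B \<in> sets M" "B \<subseteq> A" "0 < prob B" "prob B \<le> prob A / 2 ^ n"
      by blast
    obtain B' where "B' \<in> sets M" "B' \<subseteq> B" "0 < prob B'" "prob B' \<le> prob B / 2"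
      using atomless_half_subset[OF assms(1) B(1,3)] by blast
    with B show ?case by (intro bexI[of _ B']) auto
  qed
  obtain n where "(1/2 :: real) ^ n < e"
    using real_arch_pow_inv[of e "1/2"] assms(4) by auto
  moreover have "prob A / 2 ^ n \<le> (1/2) ^ n"
    by (simp add: power_divide divide_right_mono)
  ultimately have "prob A / 2 ^ n \<le> e" by linarith
  with *[of n] show ?thesis by (meson order_trans)
qed

lemma (in prob_space) atomless_subset_prob:
  assumes atomless: "atomless M" and A: "A \<in> sets M" and t: "0 \<le> t" "t \<le> prob A"
  shows "\<exists>B\<in>sets M. B \<subseteq> A \<and> prob B = t"
proof -
  \<comment> \<open>Greedy exhaustion: each step adds an event whose probability is at least half of what is
    still available, so a missing mass at the limit would leave room for a fixed gain at every
    step.\<close>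
  define P where "P B \<longleftrightarrow> B \<in> sets M \<and> B \<subseteq> A \<and> prob B \<le> t" for B
  define R where "R B B' \<longleftrightarrow> B \<subseteq> B' \<and>
    (\<forall>D\<in>sets M. D \<subseteq> A - B \<longrightarrow> prob D \<le> t - prob B \<longrightarrow> prob D \<le> 2 * (prob B' - prob B))" for B B'
  have step: "\<exists>B'. P B' \<and> R B B'" if B: "P B" for B
  proof -
    define F where "F = {C \<in> sets M. C \<subseteq> A - B \<and> prob C \<le> t - prob B}"
    have "{} \<in> F" using B by (auto simp: F_def P_def)
    have bdd: "bdd_above (prob ` F)" by (intro bdd_aboveI[of _ 1]) auto
    \<comment> \<open>The supremum over \<open>F\<close> need not be attained, but if it is
      positive, some member exceeds half of it; this is the source of the factor 2 in
      \<open>R\<close>. If it is zero, the empty event serves.\<close>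
    have "\<exists>C\<in>F. \<forall>D\<in>F. prob D \<le> 2 * prob C"
    proof (cases "Sup (prob ` F) \<le> 0")
      case True
      then have "prob D \<le> 0" if "D \<in> F" for D
        using cSup_upper[OF _ bdd, of "prob D"] that by auto
      with \<open>{} \<in> F\<close> show ?thesis by force
    next
      case False
      then have "Sup (prob ` F) / 2 < Sup (prob ` F)" by simp
      then obtain C where C: "C \<in> F" "Sup (prob ` F) / 2 < prob C"
        using less_cSup_iff[OF _ bdd, of "Sup (prob ` F) / 2"] \<open>{} \<in> F\<close> by auto
      moreover have "prob D \<le> Sup (prob ` F)" if "D \<in> F" for D
        using cSup_upper[OF _ bdd, of "prob D"] that by auto
      ultimately show ?thesis by (intro bexI[of _ C]) force+
    qed
    then obtain C where C: "C \<in> F" "\<forall>D\<in>F. prob D \<le> 2 * prob C" by blast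
    have "prob (B \<union> C) = prob B + prob C"
      using B C(1) by (intro finite_measure_Union) (auto simp: F_def P_def)
    with B C show ?thesis
      by (intro exI[of _ "B \<union> C"]) (auto simp: F_def P_def R_def)
  qed
  have "\<exists>B. \<forall>n. P (B n) \<and> R (B n) (B (Suc n))"
    by (rule dependent_nat_choice) (use t step in \<open>auto simp: P_def intro: exI[of _ "{}"]\<close>)
  then obtain B where B: "\<And>n. P (B n)" "\<And>n. R (B n) (B (Suc n))" by blast
  have [measurable]: "B n \<in> sets M" for n using B(1) by (auto simp: P_def)
  define BB where "BB = (\<Union>n. B n)"
  have BB: "BB \<in> sets M" "BB \<subseteq> A" using B(1) by (auto simp: P_def BB_def)
  have "incseq B" using B(2) by (intro incseq_SucI) (auto simp: R_def)
  then have lim: "(\<lambda>n. prob (B n)) \<longlonglongrightarrow> prob BB"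
    unfolding BB_def by (intro finite_Lim_measure_incseq) auto
  have le: "prob BB \<le> t"
    by (rule LIMSEQ_le_const2[OF lim]) (use B(1) in \<open>auto simp: P_def\<close>)
  have "prob BB = t"
  proof (rule ccontr)
    assume "prob BB \<noteq> t"
    with le have less: "prob BB < t" by simp
    have "prob (A - BB) = prob A - prob BB"
      using BB A by (intro finite_measure_Diff) auto
    with less t have "0 < prob (A - BB)" by simp
    then obtain D where D: "D \<in> sets M" "D \<subseteq> A - BB" "0 < prob D" "prob D \<le> t - prob BB"
      using atomless_small_subset[OF atomless, of "A - BB" "t - prob BB"] A BB less by auto
    have "prob D \<le> 2 * (prob (B (Suc n)) - prob (B n))" for n
    proof -
      have "prob (B n) \<le> prob BB" by (intro finite_measure_mono) (auto simp: BB_def)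
      with D have "D \<subseteq> A - B n" "prob D \<le> t - prob (B n)" by (auto simp: BB_def)
      with D(1) B(2)[of n] show ?thesis by (simp add: R_def)
    qed
    \<comment> \<open>Consecutive terms share the limit \<open>prob BB\<close>, so the increments
      tend to 0, although each is at least half of \<open>prob D\<close>.\<close>
    moreover have "(\<lambda>n. 2 * (prob (B (Suc n)) - prob (B n))) \<longlonglongrightarrow> 2 * (prob BB - prob BB)"
      by (intro tendsto_intros LIMSEQ_Suc lim)
    ultimately have "prob D \<le> 2 * (prob BB - prob BB)"
      by (intro LIMSEQ_le_const) auto
    with D show False by simp
  qed
  with BB show ?thesis by blast
qed

text \<open>Level \<open>n + 1\<close> keeps the events of level \<open>n\<close> at the even
  indices; at an odd index it adds to the lower neighbour half of the gap to the upper one. Dyadic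
  numbers with different denominators are compared by passing to a common level, where their order
  is that of the indices.\<close>

lemma (in prob_space) atomless_dyadic_chain:
  assumes "atomless M"
  shows "\<exists>f :: nat \<Rightarrow> nat \<Rightarrow> 'a set. (\<forall>n k. f n k \<in> sets M) \<and>
    (\<forall>n. \<forall>k\<le>2 ^ n. prob (f n k) = real k / 2 ^ n) \<and> (\<forall>n. f n (2 ^ n) = space M) \<and>
    (\<forall>n k m j. real k / 2 ^ n \<le> real j / 2 ^ m \<longrightarrow> f n k \<subseteq> f m j)"
proof -
  have "\<forall>A. \<exists>B. A \<in> sets M \<longrightarrow> B \<in> sets M \<and> B \<subseteq> A \<and> prob B = prob A / 2"
  proof
    fix A
    show "\<exists>B. A \<in> sets M \<longrightarrow> B \<in> sets M \<and> B \<subseteq> A \<and> prob B = prob A / 2"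
      using atomless_subset_prob[OF assms, of A "prob A / 2"] by auto
  qed
  then obtain H where H: "\<And>A. A \<in> sets M \<Longrightarrow> H A \<in> sets M \<and> H A \<subseteq> A \<and> prob (H A) = prob A / 2"
    by metis
  \<comment> \<open>At level 0 every positive index carries the whole space, so each level is nested
    along all indices and constant from \<open>2 ^ n\<close> on.\<close>
  define f :: "nat \<Rightarrow> nat \<Rightarrow> 'a set" where
    "f = rec_nat (\<lambda>k. if k = 0 then {} else space M)
      (\<lambda>n g k. if even k then g (k div 2) else g (k div 2) \<union> H (g (Suc (k div 2)) - g (k div 2)))"
  have f0: "f 0 k = (if k = 0 then {} else space M)" for k by (simp add: f_def)
  have fS: "f (Suc n) k = (if even k then f n (k div 2)
      else f n (k div 2) \<union> H (f n (Suc (k div 2)) - f n (k div 2)))" for n k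
    by (simp add: f_def)
  have sets: "f n k \<in> sets M" for n k
    by (induction n arbitrary: k) (auto simp: f0 fS H)
  have Suc_mono: "f n k \<subseteq> f n (Suc k)" for n k
  proof (induction n arbitrary: k)
    case 0
    then show ?case by (simp add: f0)
  next
    case (Suc n)
    show ?case
      using H[of "f n (Suc (k div 2)) - f n (k div 2)"] Suc[of "k div 2"] sets
      by (cases "even k") (auto simp: fS)
  qed
  have mono: "f n k \<subseteq> f n j" if "k \<le> j" for n k j
    using that Suc_mono by (rule lift_Suc_mono_le[where f="f n", rotated])
  have prob_f: "prob (f n k) = real k / 2 ^ n" if "k \<le> 2 ^ n" for n k
    using that
  proof (induction n arbitrary: k)
    case 0
    then have "k = 0 \<or> k = 1" by auto
    then show ?case by (auto simp: f0 prob_space)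
  next
    case (Suc n)
    show ?case
    proof (cases "even k")
      case True
      then show ?thesis using Suc by (auto simp: fS elim!: evenE)
    next
      case False
      then obtain l where l: "k = 2 * l + 1" by (elim oddE)
      have lS: "Suc l \<le> 2 ^ n" using Suc.prems l by auto
      have "f (Suc n) k = f n l \<union> H (f n (Suc l) - f n l)" using l by (simp add: fS)
      also have "prob \<dots> = prob (f n l) + prob (H (f n (Suc l) - f n l))"
        using H[of "f n (Suc l) - f n l"] sets by (intro finite_measure_Union) auto
      also have "prob (H (f n (Suc l) - f n l)) = (prob (f n (Suc l)) - prob (f n l)) / 2"
        using H[of "f n (Suc l) - f n l"] sets Suc_mono by (simp add: finite_measure_Diff)
      also have "prob (f n l) + (prob (f n (Suc l)) - prob (f n l)) / 2 = real k / 2 ^ Suc n"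
        using Suc.IH[of l] Suc.IH[of "Suc l"] lS l by (simp add: field_simps)
      finally show ?thesis .
    qed
  qed
  have refine: "f (n + m) (2 ^ m * k) = f n k" for n m k
    by (induction m) (simp_all add: fS mult.assoc)
  have "f n k \<subseteq> f m j" if "real k / 2 ^ n \<le> real j / 2 ^ m" for n k m j
  proof -
    have "real (2 ^ m * k) \<le> real (2 ^ n * j)"
      using that by (simp add: field_simps)
    then have "2 ^ m * k \<le> 2 ^ n * j" by (simp only: of_nat_le_iff)
    then have "f (n + m) (2 ^ m * k) \<subseteq> f (m + n) (2 ^ n * j)"
      by (simp add: mono add.commute)
    then show ?thesis by (simp only: refine)
  qed
  moreover have "f n (2 ^ n) = space M" for n
    using refine[of 0 n 1] by (simp add: f0)
  ultimately show ?thesis using sets prob_f by (intro exI[of _ f]) simp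
qed

text \<open>\<open>V\<close> assigns to a point the infimum of the dyadic numbers whose events
  contain it. The event \<open>V < t\<close> lies between two chain events with probabilities within
  \<open>(1/2) ^ m\<close> of \<open>t\<close>, for every \<open>m\<close>. Changing
  \<open>V\<close> on a null set then puts all values into the open unit interval, where quantile
  functions live.\<close>

lemma (in prob_space) atomless_uniform:
  assumes "atomless M"
  obtains U :: "'a \<Rightarrow> real" where "U \<in> borel_measurable M" "U \<in> space M \<rightarrow> {0<..<1}"
    "\<And>t. t \<in> {0..1} \<Longrightarrow> prob {\<omega> \<in> space M. U \<omega> \<le> t} = t"
proof -
  obtain f :: "nat \<Rightarrow> nat \<Rightarrow> 'a set" where f_all: "\<forall>n k. f n k \<in> sets M"
    "\<forall>n. \<forall>k\<le>2 ^ n. prob (f n k) = real k / 2 ^ n" "\<forall>n. f n (2 ^ n) = space M"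
    "\<forall>n k m j. real k / 2 ^ n \<le> real j / 2 ^ m \<longrightarrow> f n k \<subseteq> f m j"
    using atomless_dyadic_chain[OF assms] by blast
  note f = f_all[rule_format]
  have f_space: "\<omega> \<in> space M" if "\<omega> \<in> f n k" for \<omega> n k
    using that f(1) sets.sets_into_space by blast
  define D where "D \<omega> = {real k / 2 ^ n | n k. \<omega> \<in> f n k}" for \<omega>
  define V where "V \<omega> = Inf (D \<omega>)" for \<omega>
  have V_less: "V \<omega> < t \<longleftrightarrow> (\<exists>n k. real k / 2 ^ n < t \<and> \<omega> \<in> f n k)" if "\<omega> \<in> space M" for \<omega> t
  proof -
    have "D \<omega> \<noteq> {}" using f(3)[of 0] that by (auto simp: D_def)
    moreover have "bdd_below (D \<omega>)" by (intro bdd_belowI[of _ 0]) (auto simp: D_def)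
    ultimately show ?thesis unfolding V_def by (subst cInf_less_iff) (auto simp: D_def)
  qed
  have "{\<omega> \<in> space M. V \<omega> < t} = (\<Union>n. \<Union>k\<in>{k. real k / 2 ^ n < t}. f n k)" for t
  proof (intro set_eqI)
    fix \<omega>
    show "\<omega> \<in> {\<omega> \<in> space M. V \<omega> < t} \<longleftrightarrow> \<omega> \<in> (\<Union>n. \<Union>k\<in>{k. real k / 2 ^ n < t}. f n k)"
      by (cases "\<omega> \<in> space M") (auto simp: V_less dest: f_space)
  qed
  then have V[measurable]: "V \<in> borel_measurable M"
    using f(1) by (intro borel_measurable_iff_less[THEN iffD2] allI) auto
  have prob_V: "prob {\<omega> \<in> space M. V \<omega> < t} = t" if t: "0 < t" "t \<le> 1" for t
  proof (rule antisym)
    \<comment> \<open>Rounding \<open>t * 2 ^ m\<close> up gives one event of level \<open>m\<close>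
      that contains every chain event with dyadic number below \<open>t\<close>; the rounding costs
      at most \<open>(1/2) ^ m\<close>.\<close>
    have up: "prob {\<omega> \<in> space M. V \<omega> < t} \<le> t + (1/2) ^ m" for m
    proof -
      define k where "k = nat \<lceil>t * 2 ^ m\<rceil>"
      have k: "t * 2 ^ m \<le> real k" "real k \<le> t * 2 ^ m + 1"
        using t by (auto simp: k_def)
      have "t * 2 ^ m \<le> 1 * 2 ^ m" using t by (intro mult_right_mono) auto
      then have "k \<le> 2 ^ m" unfolding k_def by (simp add: nat_le_iff ceiling_le_iff)
      have "{\<omega> \<in> space M. V \<omega> < t} \<subseteq> f m k"
      proof safe
        fix \<omega> assume "\<omega> \<in> space M" "V \<omega> < t"
        then obtain n j where "real j / 2 ^ n < t" "\<omega> \<in> f n j" using V_less by blast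
        moreover have "t \<le> real k / 2 ^ m" using k(1) by (simp add: field_simps)
        ultimately show "\<omega> \<in> f m k" using f(4)[of j n k m] by auto
      qed
      then have "prob {\<omega> \<in> space M. V \<omega> < t} \<le> prob (f m k)"
        by (intro finite_measure_mono f)
      also have "\<dots> = real k / 2 ^ m" using f(2) \<open>k \<le> 2 ^ m\<close> .
      also have "\<dots> \<le> (t * 2 ^ m + 1) / 2 ^ m" using k(2) by (intro divide_right_mono) auto
      also have "\<dots> = t + (1/2) ^ m" by (simp add: field_simps)
      finally show ?thesis .
    qed
    have "(\<lambda>m. t + (1/2) ^ m) \<longlonglongrightarrow> t + 0"
      by (intro tendsto_intros) auto
    then show "prob {\<omega> \<in> space M. V \<omega> < t} \<le> t"
      using up by (intro LIMSEQ_le_const) auto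
  next
    have lo: "t - (1/2) ^ m \<le> prob {\<omega> \<in> space M. V \<omega> < t}" for m
    proof -
      \<comment> \<open>This is the largest integer strictly below \<open>t * 2 ^ m\<close>;
        strictness is what places \<open>f m k\<close> inside \<open>V < t\<close>.\<close>
      define k where "k = nat (\<lceil>t * 2 ^ m\<rceil> - 1)"
      have "0 < t * 2 ^ m" using t by simp
      then have "0 \<le> \<lceil>t * 2 ^ m\<rceil> - 1" by linarith
      then have k: "real k < t * 2 ^ m" "t * 2 ^ m - 1 \<le> real k"
        unfolding k_def by linarith+
      have "t * 2 ^ m \<le> 1 * 2 ^ m" using t by (intro mult_right_mono) auto
      with k have "real k < 2 ^ m" by linarith
      then have "k \<le> 2 ^ m" by simp
      have "real k / 2 ^ m < t" using k(1) by (simp add: field_simps)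
      then have "f m k \<subseteq> {\<omega> \<in> space M. V \<omega> < t}"
        by (auto simp: V_less[OF f_space] f_space; blast)
      then have "prob (f m k) \<le> prob {\<omega> \<in> space M. V \<omega> < t}"
        by (intro finite_measure_mono) measurable
      moreover have "prob (f m k) = real k / 2 ^ m" using f(2) \<open>k \<le> 2 ^ m\<close> .
      moreover have "t - (1/2) ^ m = (t * 2 ^ m - 1) / 2 ^ m" by (simp add: field_simps)
      moreover have "\<dots> \<le> real k / 2 ^ m" using k(2) by (intro divide_right_mono) auto
      ultimately show ?thesis by linarith
    qed
    have "(\<lambda>m. t - (1/2) ^ m) \<longlonglongrightarrow> t - 0"
      by (intro tendsto_intros) auto
    then show "t \<le> prob {\<omega> \<in> space M. V \<omega> < t}"
      using lo by (intro LIMSEQ_le_const2) auto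
  qed
  have prob_V_le0: "prob {\<omega> \<in> space M. V \<omega> \<le> 0} = 0"
  proof (rule ccontr)
    assume *: "prob {\<omega> \<in> space M. V \<omega> \<le> 0} \<noteq> 0"
    define p where "p = prob {\<omega> \<in> space M. V \<omega> \<le> 0}"
    have p: "0 < p" "p \<le> 1" using * by (auto simp: p_def zero_less_measure_iff)
    \<comment> \<open>The event \<open>V \<le> 0\<close>, of probability \<open>p\<close>, would sit
      inside \<open>V < p / 2\<close>, whose probability is only \<open>p / 2\<close>.\<close>
    have "p \<le> prob {\<omega> \<in> space M. V \<omega> < p / 2}"
      unfolding p_def[symmetric] using p(1)
      by (subst p_def, intro finite_measure_mono) auto
    also have "\<dots> = p / 2" using p by (intro prob_V) auto
    finally show False using p by simp
  qed
  have "prob {\<omega> \<in> space M. 1 \<le> V \<omega>} = 1 - prob {\<omega> \<in> space M. V \<omega> < 1}"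
    by (subst prob_compl[symmetric]) (auto intro!: arg_cong[where f=prob])
  then have prob_V_ge1: "prob {\<omega> \<in> space M. 1 \<le> V \<omega>} = 0" by (simp add: prob_V)
  \<comment> \<open>The value 1/2 is an arbitrary interior point, taken only on a null set.\<close>
  define U where "U \<omega> = (if 0 < V \<omega> \<and> V \<omega> < 1 then V \<omega> else 1 / 2)" for \<omega>
  have U[measurable]: "U \<in> borel_measurable M" unfolding U_def by measurable
  have "AE \<omega> in M. 0 < V \<omega>"
    using prob_V_le0 by (subst AE_iff_measurable[OF _ refl]) (auto simp: emeasure_eq_measure not_less)
  moreover have "AE \<omega> in M. V \<omega> < 1"
    using prob_V_ge1 by (subst AE_iff_measurable[OF _ refl]) (auto simp: emeasure_eq_measure not_less)
  ultimately have AE_U: "AE \<omega> in M. U \<omega> = V \<omega>" by eventually_elim (simp add: U_def)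
  have U_less: "prob {\<omega> \<in> space M. U \<omega> < t} = t" if "0 < t" "t \<le> 1" for t
  proof -
    have "prob {\<omega> \<in> space M. U \<omega> < t} = prob {\<omega> \<in> space M. V \<omega> < t}"
      by (rule finite_measure_eq_AE) (use AE_U in \<open>auto elim: eventually_mono\<close>)
    with prob_V that show ?thesis by simp
  qed
  show ?thesis
  proof (rule that[of U])
    show "U \<in> borel_measurable M" by fact
    show U01: "U \<in> space M \<rightarrow> {0<..<1}" by (auto simp: U_def)
    fix t :: real assume "t \<in> {0..1}"
    then consider "t = 1" | "0 \<le> t" "t < 1" by fastforce
    then show "prob {\<omega> \<in> space M. U \<omega> \<le> t} = t"
    proof cases
      case 1
      moreover have "{\<omega> \<in> space M. U \<omega> \<le> 1} = space M" using U01 by force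
      ultimately show ?thesis by (simp add: prob_space)
    next
      case 2
      show ?thesis
      proof (rule antisym)
        \<comment> \<open>The closed event lies in \<open>U < s\<close> for every \<open>s\<close>
          between \<open>t\<close> and 1, and \<open>s\<close> may approach \<open>t\<close>. The
          case \<open>t = 1\<close> was split off because it leaves no such
          \<open>s\<close>.\<close>
        show "prob {\<omega> \<in> space M. U \<omega> \<le> t} \<le> t"
        proof (rule dense_ge_bounded[OF 2(2)])
          fix s assume "t < s" "s < 1"
          then have "prob {\<omega> \<in> space M. U \<omega> \<le> t} \<le> prob {\<omega> \<in> space M. U \<omega> < s}"
            by (intro finite_measure_mono) auto
          with U_less[of s] \<open>t < s\<close> \<open>s < 1\<close> 2 show "prob {\<omega> \<in> space M. U \<omega> \<le> t} \<le> s" by simp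
        qed
        have "t \<le> prob {\<omega> \<in> space M. U \<omega> < t}"
          using U_less[of t] 2 by (cases "t = 0") auto
        also have "\<dots> \<le> prob {\<omega> \<in> space M. U \<omega> \<le> t}"
          by (intro finite_measure_mono) auto
        finally show "t \<le> prob {\<omega> \<in> space M. U \<omega> \<le> t}" .
      qed
    qed
  qed
qed

text \<open>This is the quantile transform. For \<open>u\<close> in the open unit interval, the
  generalized inverse \<open>\<mu>.I\<close> of the cdf satisfies \<open>\<mu>.I u \<le> x\<close>
  exactly when \<open>u \<le> cdf \<mu> x\<close>. Hence its composition with \<open>U\<close> has
  the cdf of \<open>\<mu>\<close>, and the cdf determines the law.\<close>

lemma (in prob_space) mono_transform_of_uniform:
  assumes U[measurable]: "U \<in> borel_measurable M" and U01: "U \<in> space M \<rightarrow> {0<..<1}"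
    and unif: "\<And>t. t \<in> {0..1} \<Longrightarrow> prob {\<omega> \<in> space M. U \<omega> \<le> t} = t"
    and \<mu>: "real_distribution \<mu>"
  obtains q where "mono_on {0<..<1} q" "has_law M (\<lambda>\<omega>. q (U \<omega>)) \<mu>"
proof -
  interpret \<mu>: cdf_distribution \<mu> using \<mu> by (simp add: cdf_distribution_def)
  define X where "X \<omega> = \<mu>.I (U \<omega>)" for \<omega>
  have level: "{\<omega> \<in> space M. X \<omega> \<le> x} = {\<omega> \<in> space M. U \<omega> \<le> cdf \<mu> x}" for x
    using U01 \<mu>.pseudoinverse by (auto simp: X_def Pi_iff)
  have meas[measurable]: "X \<in> borel_measurable M"
    by (subst borel_measurable_iff_le) (simp add: level)
  have "distr M borel X = \<mu>"
  proof (rule cdf_unique)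
    show "real_distribution (distr M borel X)"
      by (rule real_distribution_distr) measurable
    show "cdf (distr M borel X) = cdf \<mu>"
    proof
      fix x
      have "cdf (distr M borel X) x = prob {\<omega> \<in> space M. X \<omega> \<le> x}"
        unfolding cdf_def
        by (subst measure_distr[OF meas]) (auto intro!: arg_cong[where f=prob])
      also have "\<dots> = cdf \<mu> x"
        unfolding level by (intro unif) (auto simp: \<mu>.cdf_nonneg \<mu>.cdf_bounded_prob)
      finally show "cdf (distr M borel X) x = cdf \<mu> x" .
    qed
  qed (rule \<mu>)
  with meas show ?thesis by (intro that[OF \<mu>.mono_I]) (simp add: has_law_def X_def[abs_def])
qed

section \<open>Super-linear expectations and weak duality\<close>

lemma bounded_rvs_measurable[measurable_dest]: "X \<in> bounded_rvs M \<Longrightarrow> X \<in> borel_measurable M"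
  by (simp add: bounded_rvs_def)

lemma bounded_rvs_const: "(\<lambda>_. a) \<in> bounded_rvs M"
  by (auto simp: bounded_rvs_def)

lemma bounded_rvs_add:
  assumes "X \<in> bounded_rvs M" "Y \<in> bounded_rvs M"
  shows "(\<lambda>\<omega>. X \<omega> + Y \<omega>) \<in> bounded_rvs M"
proof -
  obtain C D where "AE \<omega> in M. \<bar>X \<omega>\<bar> \<le> C" "AE \<omega> in M. \<bar>Y \<omega>\<bar> \<le> D"
    using assms by (auto simp: bounded_rvs_def)
  then have "AE \<omega> in M. \<bar>X \<omega> + Y \<omega>\<bar> \<le> C + D" by eventually_elim linarith
  moreover have "(\<lambda>\<omega>. X \<omega> + Y \<omega>) \<in> borel_measurable M"
    using assms by measurable
  ultimately show ?thesis by (auto simp: bounded_rvs_def)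
qed

lemma bounded_rvs_cmult:
  assumes "X \<in> bounded_rvs M"
  shows "(\<lambda>\<omega>. l * X \<omega>) \<in> bounded_rvs M"
proof -
  obtain C where "AE \<omega> in M. \<bar>X \<omega>\<bar> \<le> C"
    using assms by (auto simp: bounded_rvs_def)
  then have "AE \<omega> in M. \<bar>l * X \<omega>\<bar> \<le> \<bar>l\<bar> * C"
    by eventually_elim (simp add: abs_mult mult_left_mono)
  moreover have "(\<lambda>\<omega>. l * X \<omega>) \<in> borel_measurable M"
    using assms by measurable
  ultimately show ?thesis by (auto simp: bounded_rvs_def)
qed

lemma bounded_rvs_sum_indicator:
  assumes "\<And>i. i \<in> I \<Longrightarrow> A i \<in> sets M"
  shows "(\<lambda>\<omega>. \<Sum>i\<in>I. indicator (A i) \<omega> :: real) \<in> bounded_rvs M"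
proof -
  have "\<bar>\<Sum>i\<in>I. indicator (A i) \<omega> :: real\<bar> \<le> (\<Sum>i\<in>I. 1)" for \<omega>
    by (rule order_trans[OF sum_abs]) (intro sum_mono, simp add: indicator_def)
  moreover have "(\<lambda>\<omega>. \<Sum>i\<in>I. indicator (A i) \<omega> :: real) \<in> borel_measurable M"
    using assms by (intro borel_measurable_sum borel_measurable_indicator)
  ultimately show ?thesis by (auto simp: bounded_rvs_def)
qed

text \<open>An essential bound \<open>C\<close> says that the law is concentrated on the interval
  from \<open>- C\<close> to \<open>C\<close>, so it passes to any variable with that law.\<close>

lemma bounded_rvs_law_invariant:
  assumes X: "X \<in> bounded_rvs M" and Y[measurable]: "Y \<in> borel_measurable M"
    and "distr M borel X = distr M borel Y"
  shows "Y \<in> bounded_rvs M"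
proof -
  have [measurable]: "X \<in> borel_measurable M" using X by measurable
  obtain C where C: "AE \<omega> in M. \<bar>X \<omega>\<bar> \<le> C"
    using X by (auto simp: bounded_rvs_def)
  then have "AE x in distr M borel X. \<bar>x\<bar> \<le> C"
    by (subst AE_distr_iff) measurable
  then have "AE \<omega> in M. \<bar>Y \<omega>\<bar> \<le> C"
    unfolding assms(3) by (subst (asm) AE_distr_iff) measurable
  with Y show ?thesis by (auto simp: bounded_rvs_def)
qed

text \<open>The complement of the support is the union of all open null sets. This union may be
  uncountable, but by Lindelof a countable subfamily covers it.\<close>

lemma AE_measure_support:
  assumes "sets \<mu> = sets borel"
  shows "AE x in \<mu>. x \<in> measure_support \<mu>"
proof -
  define F where "F = {U. open U \<and> emeasure \<mu> U = 0}"
  obtain F' where F': "F' \<subseteq> F" "countable F'" "\<Union>F' = \<Union>F"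
    using Lindelof[of F] by (auto simp: F_def)
  have "(\<Union>U\<in>F'. U) \<in> null_sets \<mu>"
    using F' assms by (intro null_sets_UN') (auto simp: F_def null_sets_def)
  moreover have "{x \<in> space \<mu>. x \<notin> measure_support \<mu>} \<subseteq> \<Union>F"
    by (auto simp: measure_support_def F_def)
  ultimately show ?thesis
    using F'(3) by (intro AE_I'[of "\<Union>F'"]) auto
qed

lemma bounded_rvs_of_compact_support:
  assumes "has_law M X \<mu>" "compact (measure_support \<mu>)"
  shows "X \<in> bounded_rvs M"
proof -
  have X[measurable]: "X \<in> borel_measurable M" and \<mu>: "distr M borel X = \<mu>"
    using assms by (auto simp: has_law_def)
  obtain C where C: "\<And>x. x \<in> measure_support \<mu> \<Longrightarrow> \<bar>x\<bar> \<le> C"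
    using compact_imp_bounded[OF assms(2)] by (auto simp: bounded_iff)
  have "AE x in \<mu>. x \<in> measure_support \<mu>"
    by (rule AE_measure_support) (simp flip: \<mu>)
  then have "AE x in distr M borel X. \<bar>x\<bar> \<le> C"
    unfolding \<mu> by eventually_elim (rule C)
  then have "AE \<omega> in M. \<bar>X \<omega>\<bar> \<le> C"
    by (rule AE_distrD[OF X])
  with X show ?thesis by (auto simp: bounded_rvs_def)
qed

section \<open>Consequences of super-linearity\<close>

lemma super_linear_expectation_mono:
  assumes "super_linear_expectation M \<E>" "X \<in> bounded_rvs M" "Y \<in> bounded_rvs M"
    "AE \<omega> in M. X \<omega> \<le> Y \<omega>"
  shows "\<E> X \<le> \<E> Y"
  using assms unfolding super_linear_expectation_def by blast

lemma super_linear_expectation_law_invariant: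
  assumes "super_linear_expectation M \<E>" "X \<in> bounded_rvs M" "Y \<in> bounded_rvs M"
    "distr M borel X = distr M borel Y"
  shows "\<E> X = \<E> Y"
  using assms unfolding super_linear_expectation_def by blast

lemma super_linear_expectation_superadditive:
  assumes "super_linear_expectation M \<E>" "X \<in> bounded_rvs M" "Y \<in> bounded_rvs M"
  shows "\<E> X + \<E> Y \<le> \<E> (\<lambda>\<omega>. X \<omega> + Y \<omega>)"
  using assms unfolding super_linear_expectation_def by blast

lemma super_linear_expectation_const:
  "super_linear_expectation M \<E> \<Longrightarrow> \<E> (\<lambda>_. a) = a"
  unfolding super_linear_expectation_def by blast

lemma super_linear_expectation_cmult:
  assumes "super_linear_expectation M \<E>" "X \<in> bounded_rvs M" "0 \<le> l"
  shows "\<E> (\<lambda>\<omega>. l * X \<omega>) = l * \<E> X"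
  using assms unfolding super_linear_expectation_def by blast

text \<open>Superadditivity is used twice: adding \<open>a\<close> to \<open>X\<close> gives one
  inequality, and adding \<open>- a\<close> to the result gives the other.\<close>

lemma super_linear_expectation_add_const:
  assumes E: "super_linear_expectation M \<E>" and X: "X \<in> bounded_rvs M"
  shows "\<E> (\<lambda>\<omega>. X \<omega> + a) = \<E> X + a"
proof -
  have "\<E> (\<lambda>\<omega>. X \<omega> + a) \<ge> \<E> X + \<E> (\<lambda>_. a)"
    by (rule super_linear_expectation_superadditive[OF E X bounded_rvs_const])
  moreover have "\<E> (\<lambda>\<omega>. (X \<omega> + a) + - a) \<ge> \<E> (\<lambda>\<omega>. X \<omega> + a) + \<E> (\<lambda>_. - a)"
    by (rule super_linear_expectation_superadditive[OF E bounded_rvs_add[OF X bounded_rvs_const]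
          bounded_rvs_const])
  moreover have "\<E> (\<lambda>_. b) = b" for b
    using E by (rule super_linear_expectation_const)
  ultimately show ?thesis by simp
qed

lemma super_linear_expectation_affine:
  assumes E: "super_linear_expectation M \<E>" and X: "X \<in> bounded_rvs M" and "0 \<le> l"
  shows "\<E> (\<lambda>\<omega>. l * X \<omega> + a) = l * \<E> X + a"
  using super_linear_expectation_add_const[OF E bounded_rvs_cmult[OF X]]
    super_linear_expectation_cmult[OF assms] by simp

text \<open>The axioms evaluate the functional only on \<open>bounded_rvs M\<close>, which is closed
  under the operations involved. The lemma carries super-linearity over to a distorted expectation
  that agrees with \<open>\<E>\<close> on this set.\<close>

lemma super_linear_expectation_cong:
  assumes "super_linear_expectation M \<E>" "\<And>X. X \<in> bounded_rvs M \<Longrightarrow> \<E> X = \<E>' X"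
  shows "super_linear_expectation M \<E>'"
  unfolding super_linear_expectation_def
proof (intro conjI ballI allI impI)
  fix X Y assume X: "X \<in> bounded_rvs M" and Y: "Y \<in> bounded_rvs M"
  show "\<E>' X \<le> \<E>' Y" if "AE \<omega> in M. X \<omega> \<le> Y \<omega>"
    using super_linear_expectation_mono[OF assms(1) X Y that] by (simp only: assms(2) X Y)
  show "\<E>' X = \<E>' Y" if "distr M borel X = distr M borel Y"
    using super_linear_expectation_law_invariant[OF assms(1) X Y that] by (simp only: assms(2) X Y)
  show "\<E>' X + \<E>' Y \<le> \<E>' (\<lambda>\<omega>. X \<omega> + Y \<omega>)"
    using super_linear_expectation_superadditive[OF assms(1) X Y]
    by (simp only: assms(2) X Y bounded_rvs_add)
next
  fix a :: real
  show "\<E>' (\<lambda>_. a) = a"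
    using super_linear_expectation_const[OF assms(1), of a] assms(2)[OF bounded_rvs_const, of a] by simp
next
  fix l :: real and X assume "0 \<le> l" and X: "X \<in> bounded_rvs M"
  then have "\<E> (\<lambda>\<omega>. l * X \<omega>) = l * \<E> X"
    by (intro super_linear_expectation_cmult[OF assms(1)])
  then show "\<E>' (\<lambda>\<omega>. l * X \<omega>) = l * \<E>' X"
    by (simp only: assms(2) X bounded_rvs_cmult)
qed

lemma weak_duality:
  assumes E: "super_linear_expectation M \<E>" and c: "cost_function M \<mu> \<nu> c"
    and X: "has_law M X\<^sub>\<mu> \<mu>" and Y: "has_law M X\<^sub>\<nu> \<nu>"
  shows "dual_value M \<E> X\<^sub>\<mu> X\<^sub>\<nu> c \<le> primal_value M \<E> \<mu> \<nu> c"
proof -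
  \<comment> \<open>The dual objective is evaluated at fixed representatives of the marginals, the
    primal one at an arbitrary coupling. Equal laws of \<open>Z\<close> and \<open>W\<close> have
    equal images under \<open>\<phi>\<close>, so boundedness and value transfer.\<close>
  have *: "(\<lambda>\<omega>. \<phi> (Z \<omega>)) \<in> bounded_rvs M \<and> \<E> (\<lambda>\<omega>. \<phi> (Z \<omega>)) = \<E> (\<lambda>\<omega>. \<phi> (W \<omega>))"
    if Z: "has_law M Z \<kappa>" and W: "has_law M W \<kappa>" and b: "(\<lambda>\<omega>. \<phi> (W \<omega>)) \<in> bounded_rvs M"
      and \<phi>[measurable]: "\<phi> \<in> borel_measurable borel" for Z W \<kappa> and \<phi> :: "real \<Rightarrow> real"
  proof -
    have [measurable]: "Z \<in> borel_measurable M" "W \<in> borel_measurable M"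
      and law: "distr M borel Z = distr M borel W"
      using Z W by (auto simp: has_law_def)
    have "distr (distr M borel Z) borel \<phi> = distr (distr M borel W) borel \<phi>"
      by (simp add: law)
    then have eq: "distr M borel (\<lambda>\<omega>. \<phi> (W \<omega>)) = distr M borel (\<lambda>\<omega>. \<phi> (Z \<omega>))"
      by (simp add: distr_distr comp_def)
    have "(\<lambda>\<omega>. \<phi> (Z \<omega>)) \<in> bounded_rvs M"
      by (rule bounded_rvs_law_invariant[OF b _ eq]) measurable
    with super_linear_expectation_law_invariant[OF E b this eq] show ?thesis by simp
  qed
  have "\<E> (\<lambda>\<omega>. \<phi> (X\<^sub>\<mu> \<omega>)) + \<E> (\<lambda>\<omega>. \<psi> (X\<^sub>\<nu> \<omega>)) \<le> \<E> (\<lambda>\<omega>. c (Z \<omega>, W \<omega>))"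
    if d: "(\<phi>, \<psi>) \<in> dual_pairs M X\<^sub>\<mu> X\<^sub>\<nu> c" and cp: "(Z, W) \<in> couplings M \<mu> \<nu>" for \<phi> \<psi> Z W
  proof -
    have Z: "has_law M Z \<mu>" "has_law M W \<nu>" using cp by (auto simp: couplings_def)
    have \<phi>: "(\<lambda>\<omega>. \<phi> (Z \<omega>)) \<in> bounded_rvs M" "\<E> (\<lambda>\<omega>. \<phi> (Z \<omega>)) = \<E> (\<lambda>\<omega>. \<phi> (X\<^sub>\<mu> \<omega>))"
      using *[OF Z(1) X, of \<phi>] d by (auto simp: dual_pairs_def)
    have \<psi>: "(\<lambda>\<omega>. \<psi> (W \<omega>)) \<in> bounded_rvs M" "\<E> (\<lambda>\<omega>. \<psi> (W \<omega>)) = \<E> (\<lambda>\<omega>. \<psi> (X\<^sub>\<nu> \<omega>))"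
      using *[OF Z(2) Y, of \<psi>] d by (auto simp: dual_pairs_def)
    have "\<E> (\<lambda>\<omega>. \<phi> (Z \<omega>)) + \<E> (\<lambda>\<omega>. \<psi> (W \<omega>)) \<le> \<E> (\<lambda>\<omega>. \<phi> (Z \<omega>) + \<psi> (W \<omega>))"
      by (rule super_linear_expectation_superadditive[OF E \<phi>(1) \<psi>(1)])
    also have "\<dots> \<le> \<E> (\<lambda>\<omega>. c (Z \<omega>, W \<omega>))"
    proof -
      have "(\<lambda>\<omega>. c (Z \<omega>, W \<omega>)) \<in> bounded_rvs M"
        using c cp by (auto simp: cost_function_def)
      moreover have "AE \<omega> in M. \<phi> (Z \<omega>) + \<psi> (W \<omega>) \<le> c (Z \<omega>, W \<omega>)"
        using d by (auto simp: dual_pairs_def)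
      ultimately show ?thesis
        by (rule super_linear_expectation_mono[OF E bounded_rvs_add[OF \<phi>(1) \<psi>(1)]])
    qed
    finally show ?thesis by (simp add: \<phi>(2) \<psi>(2))
  qed
  then show ?thesis
    unfolding dual_value_def primal_value_def by (auto intro!: SUP_least INF_greatest)
qed

section \<open>Comonotone additivity of distorted expectations\<close>

context prob_space
begin

context
  fixes h :: "real \<Rightarrow> real"
  assumes h: "distortion_function h"
begin

lemma distortion_bounds: "0 \<le> h (prob A)" "h (prob A) \<le> 1"
  using h by (auto simp: distortion_function_def Pi_iff)

lemma distortion_empty: "h (prob {}) = 0"
  using h by (simp add: distortion_function_def)

text \<open>For \<open>x < 0\<close> the event \<open>X > x\<close> is the whole space, so the
  second integrand is \<open>h 1 - 1 = 0\<close>. It may differ from 0 at the endpoint 0, which is a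
  Lebesgue null set.\<close>

lemma distorted_expectation_nonneg:
  assumes "\<And>\<omega>. \<omega> \<in> space M \<Longrightarrow> 0 \<le> X \<omega>"
  shows "distorted_expectation M h X = (LINT x:{0..}|lborel. h (prob {\<omega>\<in>space M. X \<omega> > x}))"
proof -
  have "h (prob {\<omega> \<in> space M. x < X \<omega>}) = 1" if "x < 0" for x
  proof -
    have "{\<omega> \<in> space M. x < X \<omega>} = space M" using assms that by force
    then show ?thesis using h by (simp add: prob_space distortion_function_def)
  qed
  then have "(LINT x:{..0}|lborel. h (prob {\<omega>\<in>space M. X \<omega> > x}) - 1) = 0"
    unfolding set_lebesgue_integral_def using AE_lborel_singleton[of "0::real"]
    by (intro integral_eq_zero_AE) (auto simp: indicator_def elim!: eventually_mono)
  then show ?thesis by (simp add: distorted_expectation_def)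
qed

lemma distorted_expectation_zero: "distorted_expectation M h (\<lambda>_. 0) = 0"
  by (subst distorted_expectation_nonneg)
    (auto simp: set_lebesgue_integral_def indicator_def distortion_empty[simplified]
      intro!: integral_eq_zero_AE)

text \<open>Since \<open>Z\<close> vanishes off \<open>C\<close>, the level set of the sum at
  \<open>x\<close> is \<open>C\<close> itself for \<open>x\<close> in [0, 1) and the level set of
  \<open>Z\<close> at \<open>x - 1\<close> for \<open>x \<ge> 1\<close>. The first range contributes
  \<open>h (prob C)\<close>, the second a translate of the integral for \<open>Z\<close>.\<close>

lemma distorted_expectation_add_indicator:
  assumes C: "C \<in> sets M" and Z[measurable]: "Z \<in> borel_measurable M"
    and bounds: "\<And>\<omega>. \<omega> \<in> space M \<Longrightarrow> 0 \<le> Z \<omega>" "\<And>\<omega>. \<omega> \<in> space M \<Longrightarrow> Z \<omega> \<le> K"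
    and off: "\<And>\<omega>. \<omega> \<in> space M \<Longrightarrow> \<omega> \<notin> C \<Longrightarrow> Z \<omega> = 0"
  shows "distorted_expectation M h (\<lambda>\<omega>. indicator C \<omega> + Z \<omega>) =
    h (prob C) + distorted_expectation M h Z"
proof -
  define G where "G x = h (prob {\<omega> \<in> space M. Z \<omega> > x})" for x
  \<comment> \<open>With the cutoff, the translate \<open>G0 (x - 1)\<close> vanishes for
    \<open>x < 1\<close>, so the two ranges can be added over the whole line.\<close>
  define G0 where "G0 x = indicator {0..} x * G x" for x
  have G_mono: "G y \<le> G x" if "x \<le> y" for x y
  proof -
    have "prob {\<omega> \<in> space M. y < Z \<omega>} \<le> prob {\<omega> \<in> space M. x < Z \<omega>}"
      using that by (intro finite_measure_mono) auto
    then show ?thesis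
      using h unfolding G_def distortion_function_def by (auto intro: mono_onD)
  qed
  \<comment> \<open>\<open>h\<close> is only known to be monotone; measurability of \<open>G\<close>
    comes from its being decreasing.\<close>
  have "mono (\<lambda>x. - G x)" using G_mono by (intro monoI) auto
  then have "(\<lambda>x. - (- G x)) \<in> borel_measurable borel"
    by (intro borel_measurable_uminus borel_measurable_mono)
  then have [measurable]: "G \<in> borel_measurable borel" by simp
  have G_zero: "G x = 0" if "x \<ge> K" for x
  proof -
    have "{\<omega> \<in> space M. x < Z \<omega>} = {}" using bounds(2) that by force
    then show ?thesis using distortion_empty by (simp only: G_def)
  qed
  have G_range: "0 \<le> G x" "G x \<le> 1" for x by (auto simp: G_def distortion_bounds)
  have G0_int: "integrable lborel G0"
  proof (rule Bochner_Integration.integrable_bound)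
    show "integrable lborel (indicator {0..K} :: real \<Rightarrow> real)"
      by (simp add: emeasure_lborel_Icc_eq)
    show "AE x in lborel. norm (G0 x) \<le> norm (indicator {0..K} x :: real)"
      using G_zero G_range by (intro AE_I2) (auto simp: G0_def indicator_def)
    show "G0 \<in> borel_measurable lborel" unfolding G0_def by measurable
  qed
  have shift: "integrable lborel (\<lambda>x. G0 (x - 1))" "(LINT x|lborel. G0 (x - 1)) = (LINT x|lborel. G0 x)"
    using lborel_integrable_real_affine[OF G0_int, of 1 "-1"]
      lborel_integral_real_affine[of 1 G0 "-1"] by (simp_all add: add.commute)
  have layer: "h (prob {\<omega> \<in> space M. indicator C \<omega> + Z \<omega> > x}) =
    h (prob C) * indicator {0..<1} x + G0 (x - 1)" if "0 \<le> x" for x :: real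
  proof (cases "x < 1")
    case True
    then have "{\<omega> \<in> space M. indicator C \<omega> + Z \<omega> > x} = C"
      using bounds(1) off sets.sets_into_space[OF C] that
      by (force simp: indicator_def split: if_splits)
    with True that show ?thesis by (simp add: G0_def)
  next
    case False
    then have "indicator C \<omega> + Z \<omega> > x \<longleftrightarrow> Z \<omega> > x - 1" if "\<omega> \<in> space M" for \<omega>
      using off[OF that] by (auto simp: indicator_def)
    then have "{\<omega> \<in> space M. indicator C \<omega> + Z \<omega> > x} = {\<omega> \<in> space M. Z \<omega> > x - 1}" by blast
    with False show ?thesis by (simp add: G0_def G_def)
  qed
  have "distorted_expectation M h (\<lambda>\<omega>. indicator C \<omega> + Z \<omega>) =
    (LINT x:{0..}|lborel. h (prob {\<omega> \<in> space M. indicator C \<omega> + Z \<omega> > x}))"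
    using bounds(1) by (intro distorted_expectation_nonneg) (simp add: indicator_def)
  also have "\<dots> = (LINT x|lborel. h (prob C) * indicator {0..<1} x + G0 (x - 1))"
    unfolding set_lebesgue_integral_def
  proof (intro Bochner_Integration.integral_cong refl)
    fix x :: real
    show "indicator {0..} x *\<^sub>R h (prob {\<omega> \<in> space M. indicator C \<omega> + Z \<omega> > x}) =
      h (prob C) * indicator {0..<1} x + G0 (x - 1)"
      by (cases "0 \<le> x") (simp_all add: layer, simp add: G0_def)
  qed
  also have "\<dots> = (LINT x|lborel. h (prob C) * indicator {0..<1::real} x) + (LINT x|lborel. G0 x)"
    by (subst Bochner_Integration.integral_add) (auto simp: shift)
  also have "(LINT x|lborel. h (prob C) * indicator {0..<1::real} x) = h (prob C)"
    by simp
  also have "(LINT x|lborel. G0 x) = distorted_expectation M h Z"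
    by (subst distorted_expectation_nonneg)
      (auto simp: bounds set_lebesgue_integral_def G0_def[abs_def] G_def)
  finally show ?thesis .
qed

text \<open>Induction on the index set: a maximal event of the chain contains all the others, so the
  remaining sum vanishes off it and \<open>distorted_expectation_add_indicator\<close> splits off
  its indicator.\<close>

lemma distorted_expectation_chain:
  assumes "finite I" "\<And>i. i \<in> I \<Longrightarrow> A i \<in> sets M"
    and "\<And>i j. i \<in> I \<Longrightarrow> j \<in> I \<Longrightarrow> A i \<subseteq> A j \<or> A j \<subseteq> A i"
  shows "distorted_expectation M h (\<lambda>\<omega>. \<Sum>i\<in>I. indicator (A i) \<omega>) = (\<Sum>i\<in>I. h (prob (A i)))"
  using assms
proof (induction I rule: finite_psubset_induct)
  case (psubset I)
  show ?case
  proof (cases "I = {}")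
    case True
    then show ?thesis by (simp add: distorted_expectation_zero)
  next
    case False
    obtain i where i: "i \<in> I" "\<And>j. j \<in> I \<Longrightarrow> A i \<subseteq> A j \<Longrightarrow> A i = A j"
      using finite_has_maximal[of "A ` I"] psubset.hyps False by auto
    define J where "J = I - {i}"
    have I: "I = insert i J" "i \<notin> J" "finite J" "J \<subset> I"
      using i(1) psubset.hyps by (auto simp: J_def)
    have sub: "A j \<subseteq> A i" if "j \<in> J" for j
      using psubset.prems(2)[of i j] i that I by blast
    define Z where "Z \<omega> = (\<Sum>j\<in>J. indicator (A j) \<omega> :: real)" for \<omega>
    have "distorted_expectation M h (\<lambda>\<omega>. indicator (A i) \<omega> + Z \<omega>) =
      h (prob (A i)) + distorted_expectation M h Z"
    proof (rule distorted_expectation_add_indicator[where K = "real (card J)"])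
      show "A i \<in> sets M" using psubset.prems(1) i(1) .
      show "Z \<in> borel_measurable M"
        unfolding Z_def using psubset.prems(1) I
        by (intro borel_measurable_sum borel_measurable_indicator) auto
      show "0 \<le> Z \<omega>" for \<omega> unfolding Z_def by (intro sum_nonneg) auto
      show "Z \<omega> \<le> real (card J)" for \<omega>
        unfolding Z_def by (rule order_trans[OF sum_mono[where g="\<lambda>_. 1"]]) (auto simp: indicator_def)
      show "Z \<omega> = 0" if "\<omega> \<notin> A i" for \<omega>
        unfolding Z_def using sub that by (intro sum.neutral) (auto simp: indicator_def)
    qed
    also have "distorted_expectation M h Z = (\<Sum>j\<in>J. h (prob (A j)))"
      unfolding Z_def using psubset.prems I by (intro psubset.IH) auto
    finally show ?thesis using I by (simp add: Z_def)
  qed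
qed

end

end

section \<open>Comonotone variables and their approximation by level sets\<close>

lemma sum_of_bool_le_eq_floor:
  fixes z :: real
  assumes "0 \<le> z" "z \<le> real N"
  shows "(\<Sum>k\<in>{1..N}. of_bool (real k \<le> z)) = real_of_int \<lfloor>z\<rfloor>"
proof -
  have "(\<Sum>k\<in>{1..N}. of_bool (real k \<le> z)) = real (card {k \<in> {1..N}. real k \<le> z})"
    by (simp add: Int_def)
  \<comment> \<open>The bound \<open>z \<le> N\<close> ensures that the cap at \<open>N\<close> cuts
    off no integer below \<open>z\<close>.\<close>
  also have "{k \<in> {1..N}. real k \<le> z} = {1..nat \<lfloor>z\<rfloor>}"
    using assms by (auto simp: le_nat_iff le_floor_iff)
  finally show ?thesis using assms by simp
qed

text \<open>Equivalent to \<open>(X \<omega> - X \<omega>') * (Y \<omega> - Y \<omega>') \<ge>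
  0\<close> for all pairs of points, hence symmetric in \<open>X\<close> and
  \<open>Y\<close>.\<close>

definition comonotone_on :: "'a set \<Rightarrow> ('a \<Rightarrow> real) \<Rightarrow> ('a \<Rightarrow> real) \<Rightarrow> bool" where
  "comonotone_on S X Y \<longleftrightarrow> (\<forall>\<omega>\<in>S. \<forall>\<omega>'\<in>S. X \<omega> < X \<omega>' \<longrightarrow> Y \<omega> \<le> Y \<omega>')"

text \<open>If both inclusions failed, one witness would have the strictly larger \<open>X\<close>
  and the other the strictly larger \<open>Y\<close>.\<close>

lemma comonotone_on_level_sets:
  assumes "comonotone_on S X Y"
  shows "{\<omega>\<in>S. s \<le> X \<omega>} \<subseteq> {\<omega>\<in>S. t \<le> Y \<omega>} \<or> {\<omega>\<in>S. t \<le> Y \<omega>} \<subseteq> {\<omega>\<in>S. s \<le> X \<omega>}"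
  using assms unfolding comonotone_on_def by (smt (verit) mem_Collect_eq subsetI)

text \<open>Both variables are rounded to a grid of width \<open>1 / n\<close>, which turns them
  into affine images of sums of level-set indicators. Comonotonicity makes all these level sets one
  chain, so the rounded variables are additive; the rounding error is at most \<open>2 / n\<close>.
  The reverse inequality is superadditivity.\<close>

lemma (in prob_space) distorted_expectation_comonotone:
  fixes X Y :: "'a \<Rightarrow> real"
  assumes h: "distortion_function h"
    and D: "super_linear_expectation M (distorted_expectation M h)"
    and X: "X \<in> bounded_rvs M" and Y: "Y \<in> bounded_rvs M"
    and como: "comonotone_on (space M) X Y"
  shows "distorted_expectation M h (\<lambda>\<omega>. X \<omega> + Y \<omega>) \<le>
    distorted_expectation M h X + distorted_expectation M h Y"
proof -
  let ?D = "distorted_expectation M h"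
  have [measurable]: "X \<in> borel_measurable M" "Y \<in> borel_measurable M" using X Y by auto
  have D_mono: "?D V \<le> ?D W"
    if "V \<in> bounded_rvs M" "W \<in> bounded_rvs M" "AE \<omega> in M. V \<omega> \<le> W \<omega>" for V W
    using D that by (rule super_linear_expectation_mono)
  obtain C C' where C: "AE \<omega> in M. \<bar>X \<omega>\<bar> \<le> C" "AE \<omega> in M. \<bar>Y \<omega>\<bar> \<le> C'"
    using X Y by (auto simp: bounded_rvs_def)
  obtain K :: nat where "max C C' \<le> real K" using real_arch_simple by blast
  then have K: "AE \<omega> in M. \<bar>X \<omega>\<bar> \<le> real K" "AE \<omega> in M. \<bar>Y \<omega>\<bar> \<le> real K"
    using C by (force elim: eventually_mono)+
  have bound: "?D (\<lambda>\<omega>. X \<omega> + Y \<omega>) \<le> ?D X + ?D Y + 2 / real n" if n: "0 < n" for n :: nat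
  proof -
    \<comment> \<open>The number of steps of width \<open>1 / n\<close> in the interval from
      \<open>- K\<close> to \<open>K\<close>.\<close>
    define N where "N = 2 * K * n"
    define L where "L V k = {\<omega> \<in> space M. real k / real n - real K \<le> V \<omega>}" for V :: "'a \<Rightarrow> real" and k
    \<comment> \<open>\<open>S V / n - K\<close> is \<open>V\<close> rounded down to a multiple of \<open>1 / n\<close>.\<close>
    define S where "S V \<omega> = (\<Sum>k\<in>{1..N}. indicator (L V k) \<omega> :: real)" for V \<omega>
    have L_sets: "L X k \<in> sets M" "L Y k \<in> sets M" for k
      by (auto simp: L_def)
    have S_rvs: "S X \<in> bounded_rvs M" "S Y \<in> bounded_rvs M"
      unfolding S_def using L_sets by (intro bounded_rvs_sum_indicator; simp)+
    have S_bounds: "(1 / n) * S V \<omega> + - real K \<le> V \<omega>" "V \<omega> \<le> (1 / n) * S V \<omega> + - real K + 1 / n"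
      if \<omega>: "\<omega> \<in> space M" and V: "\<bar>V \<omega>\<bar> \<le> real K" for V \<omega>
    proof -
      \<comment> \<open>The value of \<open>V\<close> in grid units, counted from
        \<open>- K\<close>: the point lies in \<open>L V k\<close> exactly when
        \<open>k \<le> z\<close>, so \<open>S V\<close> is the floor of \<open>z\<close>.\<close>
      define z where "z = real n * (V \<omega> + real K)"
      have z: "0 \<le> z" using V by (simp add: z_def)
      have "z \<le> real n * (2 * real K)"
        unfolding z_def using V by (intro mult_left_mono) auto
      then have zN: "z \<le> real N" by (simp add: N_def algebra_simps)
      have "indicator (L V k) \<omega> = (of_bool (real k \<le> z) :: real)" for k
        using \<omega> n by (simp add: L_def z_def indicator_def field_simps)
      then have "S V \<omega> = real_of_int \<lfloor>z\<rfloor>"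
        unfolding S_def using sum_of_bool_le_eq_floor[OF z zN] by simp
      then have "S V \<omega> \<le> z" "z \<le> S V \<omega> + 1" by linarith+
      then show "(1 / n) * S V \<omega> + - real K \<le> V \<omega>" "V \<omega> \<le> (1 / n) * S V \<omega> + - real K + 1 / n"
        using n by (simp_all add: z_def field_simps)
    qed
    have lower: "(1 / n) * ?D (S V) + - real K \<le> ?D V"
      if V: "V \<in> bounded_rvs M" "AE \<omega> in M. \<bar>V \<omega>\<bar> \<le> real K" and S: "S V \<in> bounded_rvs M" for V
    proof -
      have "(1 / n) * ?D (S V) + - real K = ?D (\<lambda>\<omega>. (1 / n) * S V \<omega> + - real K)"
        by (rule super_linear_expectation_affine[OF D S, symmetric]) simp
      also have "\<dots> \<le> ?D V"
      proof (rule D_mono)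
        show "AE \<omega> in M. (1 / n) * S V \<omega> + - real K \<le> V \<omega>"
          using V(2) AE_space by eventually_elim (rule S_bounds(1))
      qed (intro bounded_rvs_add bounded_rvs_cmult bounded_rvs_const S V)+
      finally show ?thesis .
    qed
    have S_sum: "?D (\<lambda>\<omega>. S X \<omega> + S Y \<omega>) = ?D (S X) + ?D (S Y)"
    proof -
      \<comment> \<open>Indexing by a disjoint sum counts an event twice if it is a level set of
        both variables.\<close>
      define A where "A = case_sum (L X) (L Y)"
      have L_chain: "L V j \<subseteq> L V k \<or> L V k \<subseteq> L V j" for V j k
        by (cases "j \<le> k") (auto simp: L_def divide_right_mono intro: order_trans[rotated])
      have A_chain: "A i \<subseteq> A j \<or> A j \<subseteq> A i" for i j
        using comonotone_on_level_sets[OF como] L_chain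
        by (cases i; cases j) (simp_all add: A_def L_def, blast)
      have A_sets: "A i \<in> sets M" for i by (cases i) (simp_all add: A_def L_sets)
      have "(\<lambda>\<omega>. S X \<omega> + S Y \<omega>) = (\<lambda>\<omega>. \<Sum>i\<in>{1..N} <+> {1..N}. indicator (A i) \<omega>)"
        by (simp add: S_def sum.Plus A_def fun_eq_iff)
      then have "?D (\<lambda>\<omega>. S X \<omega> + S Y \<omega>) = (\<Sum>i\<in>{1..N} <+> {1..N}. h (prob (A i)))"
        using distorted_expectation_chain[OF h, of "{1..N} <+> {1..N}" A] A_chain A_sets by simp
      also have "\<dots> = (\<Sum>k\<in>{1..N}. h (prob (L X k))) + (\<Sum>k\<in>{1..N}. h (prob (L Y k)))"
        by (simp add: sum.Plus A_def)
      also have "\<dots> = ?D (S X) + ?D (S Y)"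
        unfolding S_def using L_chain L_sets by (simp add: distorted_expectation_chain[OF h])
      finally show ?thesis .
    qed
    have SS: "(\<lambda>\<omega>. S X \<omega> + S Y \<omega>) \<in> bounded_rvs M" by (intro bounded_rvs_add S_rvs)
    \<comment> \<open>Each variable exceeds its rounded version by at most \<open>1 / n\<close>. The
      shift \<open>- 2 * real K\<close> cancels against the two uses of
      \<open>lower\<close>.\<close>
    have "?D (\<lambda>\<omega>. X \<omega> + Y \<omega>) \<le> ?D (\<lambda>\<omega>. (1 / n) * (S X \<omega> + S Y \<omega>) + (2 / n - 2 * real K))"
    proof (rule D_mono)
      show "AE \<omega> in M. X \<omega> + Y \<omega> \<le> (1 / n) * (S X \<omega> + S Y \<omega>) + (2 / n - 2 * real K)"
        using K AE_space
      proof eventually_elim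
        case (elim \<omega>)
        with S_bounds(2)[of \<omega> X] S_bounds(2)[of \<omega> Y] show ?case
          by (simp add: add_divide_distrib)
      qed
    qed (intro bounded_rvs_add bounded_rvs_cmult bounded_rvs_const S_rvs X Y)+
    also have "\<dots> = (1 / n) * (?D (S X) + ?D (S Y)) + (2 / n - 2 * real K)"
      by (subst super_linear_expectation_affine[OF D SS]) (simp_all add: S_sum)
    also have "\<dots> \<le> ?D X + ?D Y + 2 / n"
      using lower[OF X K(1) S_rvs(1)] lower[OF Y K(2) S_rvs(2)] by (simp add: add_divide_distrib)
    finally show ?thesis .
  qed
  have "(\<lambda>n. ?D X + ?D Y + 2 / real n) \<longlonglongrightarrow> ?D X + ?D Y + 0"
    by (intro tendsto_intros lim_const_over_n)
  then show ?thesis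
    using bound by (intro LIMSEQ_le_const) (auto intro!: exI[of _ 1])
qed

section \<open>Comonotone couplings and strong duality\<close>

text \<open>For negative \<open>\<beta>\<close> the quantile transform is applied to the law
  reflected at 0: with \<open>X = - q (U)\<close>, the product
  \<open>\<beta> * X = (- \<beta>) * q (U)\<close> is again nondecreasing in \<open>U\<close>. So
  both scaled marginals can be driven by the same \<open>U\<close>, whatever the signs.\<close>

lemma (in prob_space) scaled_mono_transform_of_uniform:
  assumes U: "U \<in> borel_measurable M" "U \<in> space M \<rightarrow> {0<..<1}"
    "\<And>t. t \<in> {0..1} \<Longrightarrow> prob {\<omega> \<in> space M. U \<omega> \<le> t} = t"
    and \<mu>: "real_distribution \<mu>"
  obtains X q where "has_law M X \<mu>" "mono_on {0<..<1} q" "\<And>\<omega>. \<beta> * X \<omega> = q (U \<omega>)"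
proof (cases "0 \<le> \<beta>")
  case True
  obtain q where q: "mono_on {0<..<1} q" "has_law M (\<lambda>\<omega>. q (U \<omega>)) \<mu>"
    using mono_transform_of_uniform[OF U \<mu>] .
  show ?thesis
    using q True by (intro that[of "\<lambda>\<omega>. q (U \<omega>)" "\<lambda>u. \<beta> * q u"])
      (auto simp: mono_on_def mult_left_mono)
next
  case False
  interpret \<mu>: real_distribution \<mu> by (rule \<mu>)
  have "real_distribution (distr \<mu> borel uminus)"
    by (intro \<mu>.real_distribution_distr) simp
  from mono_transform_of_uniform[OF U this] obtain q
    where q: "mono_on {0<..<1} q" "has_law M (\<lambda>\<omega>. q (U \<omega>)) (distr \<mu> borel uminus)" .
  have [measurable]: "(\<lambda>\<omega>. q (U \<omega>)) \<in> borel_measurable M"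
    using q(2) by (simp add: has_law_def)
  have "distr M borel (\<lambda>\<omega>. - q (U \<omega>)) = distr (distr M borel (\<lambda>\<omega>. q (U \<omega>))) borel uminus"
    by (simp add: distr_distr comp_def)
  also have "\<dots> = distr (distr \<mu> borel uminus) borel uminus"
    using q(2) by (simp add: has_law_def)
  also have "\<dots> = distr \<mu> borel (\<lambda>x. x)"
    by (subst distr_distr) (auto simp: comp_def)
  also have "\<dots> = \<mu>" by (rule distr_id2) (simp)
  finally have "has_law M (\<lambda>\<omega>. - q (U \<omega>)) \<mu>" by (simp add: has_law_def)
  then show ?thesis
    using q(1) False by (intro that[of "\<lambda>\<omega>. - q (U \<omega>)" "\<lambda>u. (- \<beta>) * q u"])
      (auto simp: mono_on_def mult_left_mono_neg)
qed

theorem theorem2: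
  fixes M :: "'a measure" and \<E> :: "('a \<Rightarrow> real) \<Rightarrow> real"
    and \<mu> \<nu> :: "real measure" and c :: "real \<times> real \<Rightarrow> real"
    and X\<^sub>\<mu> X\<^sub>\<nu> :: "'a \<Rightarrow> real"
  assumes "prob_space M" and "atomless M"
    and "super_linear_expectation M \<E>"
    and "real_distribution \<mu>" and "compact (measure_support \<mu>)"
    and "real_distribution \<nu>" and "compact (measure_support \<nu>)"
    and "cost_function M \<mu> \<nu> c"
    and "has_law M X\<^sub>\<mu> \<mu>" and "has_law M X\<^sub>\<nu> \<nu>"
  shows "primal_value M \<E> \<mu> \<nu> c \<ge> dual_value M \<E> X\<^sub>\<mu> X\<^sub>\<nu> c \<and>
    (\<forall>\<alpha> \<beta> \<gamma> h.
       (\<forall>x y. c (x, y) = \<alpha> + \<beta> * x + \<gamma> * y) \<longrightarrow>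
       distortion_function h \<longrightarrow>
       (\<forall>X\<in>bounded_rvs M. \<E> X = distorted_expectation M h X) \<longrightarrow>
       primal_value M (distorted_expectation M h) \<mu> \<nu> c =
         dual_value M (distorted_expectation M h) X\<^sub>\<mu> X\<^sub>\<nu> c)"
proof (intro conjI allI impI)
  show "dual_value M \<E> X\<^sub>\<mu> X\<^sub>\<nu> c \<le> primal_value M \<E> \<mu> \<nu> c"
    by (rule weak_duality) fact+
next
  fix \<alpha> \<beta> \<gamma> h
  assume c: "\<forall>x y. c (x, y) = \<alpha> + \<beta> * x + \<gamma> * y" and h: "distortion_function h"
    and eq: "\<forall>X\<in>bounded_rvs M. \<E> X = distorted_expectation M h X"
  let ?D = "distorted_expectation M h"
  interpret prob_space M by fact
  have D: "super_linear_expectation M ?D"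
    using super_linear_expectation_cong[OF assms(3)] eq by blast
  obtain U :: "'a \<Rightarrow> real" where U: "U \<in> borel_measurable M" "U \<in> space M \<rightarrow> {0<..<1}"
    "\<And>t. t \<in> {0..1} \<Longrightarrow> prob {\<omega> \<in> space M. U \<omega> \<le> t} = t"
    using atomless_uniform[OF assms(2)] by blast
  obtain X q where X: "has_law M X \<mu>" "mono_on {0<..<1} q" "\<And>\<omega>. \<beta> * X \<omega> = q (U \<omega>)"
    using scaled_mono_transform_of_uniform[OF U assms(4), where \<beta> = \<beta>] by blast
  obtain Y r where Y: "has_law M Y \<nu>" "mono_on {0<..<1} r" "\<And>\<omega>. \<gamma> * Y \<omega> = r (U \<omega>)"
    using scaled_mono_transform_of_uniform[OF U assms(6), where \<beta> = \<gamma>] by blast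
  have bdd: "X \<in> bounded_rvs M" "Y \<in> bounded_rvs M" "X\<^sub>\<mu> \<in> bounded_rvs M" "X\<^sub>\<nu> \<in> bounded_rvs M"
    using X(1) Y(1) assms by (auto intro: bounded_rvs_of_compact_support)
  have law_inv: "?D (\<lambda>\<omega>. b * V \<omega>) = ?D (\<lambda>\<omega>. b * W \<omega>)"
    if V: "has_law M V \<kappa>" "has_law M W \<kappa>" "V \<in> bounded_rvs M" "W \<in> bounded_rvs M"
    for V W \<kappa> and b :: real
  proof -
    have [measurable]: "V \<in> borel_measurable M" "W \<in> borel_measurable M"
      and "distr M borel V = distr M borel W"
      using V by (auto simp: has_law_def)
    then have "distr (distr M borel V) borel ((*) b) = distr (distr M borel W) borel ((*) b)"
      by simp
    then have "distr M borel (\<lambda>\<omega>. b * V \<omega>) = distr M borel (\<lambda>\<omega>. b * W \<omega>)"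
      by (simp add: distr_distr comp_def)
    then show ?thesis
      by (rule super_linear_expectation_law_invariant[OF D bounded_rvs_cmult[OF V(3)]
            bounded_rvs_cmult[OF V(4)]])
  qed
  have como: "comonotone_on (space M) (\<lambda>\<omega>. \<beta> * X \<omega>) (\<lambda>\<omega>. \<gamma> * Y \<omega>)"
    unfolding comonotone_on_def X(3) Y(3)
  proof (intro ballI impI)
    fix \<omega> \<omega>' assume \<omega>: "\<omega> \<in> space M" "\<omega>' \<in> space M" and less: "q (U \<omega>) < q (U \<omega>')"
    have range: "U \<omega> \<in> {0<..<1}" "U \<omega>' \<in> {0<..<1}" using U(2) \<omega> by auto
    \<comment> \<open>The reverse order of the uniform values would, by monotonicity of
      \<open>q\<close>, contradict \<open>less\<close>.\<close>
    have "U \<omega> \<le> U \<omega>'"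
      using mono_onD[OF X(2) range(2) range(1)] less by linarith
    then show "r (U \<omega>) \<le> r (U \<omega>')" using mono_onD[OF Y(2) range] by blast
  qed
  have "primal_value M ?D \<mu> \<nu> c \<le> ereal (?D (\<lambda>\<omega>. c (X \<omega>, Y \<omega>)))"
    unfolding primal_value_def using X(1) Y(1)
    by (intro INF_lower2[of "(X, Y)"]) (auto simp: couplings_def)
  also have "?D (\<lambda>\<omega>. c (X \<omega>, Y \<omega>)) = ?D (\<lambda>\<omega>. (\<beta> * X \<omega> + \<gamma> * Y \<omega>) + \<alpha>)"
    by (simp add: c algebra_simps)
  also have "\<dots> = ?D (\<lambda>\<omega>. \<beta> * X \<omega> + \<gamma> * Y \<omega>) + \<alpha>"
    by (intro super_linear_expectation_add_const[OF D] bounded_rvs_add bounded_rvs_cmult bdd)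
  also have "ereal \<dots> \<le> ereal (?D (\<lambda>\<omega>. \<beta> * X \<omega>) + ?D (\<lambda>\<omega>. \<gamma> * Y \<omega>) + \<alpha>)"
    using distorted_expectation_comonotone[OF h D bounded_rvs_cmult bounded_rvs_cmult como] bdd
    by simp
  \<comment> \<open>After the split only the marginal laws matter, so the coupled variables are
    replaced by the given representatives.\<close>
  also have "?D (\<lambda>\<omega>. \<beta> * X \<omega>) + ?D (\<lambda>\<omega>. \<gamma> * Y \<omega>) + \<alpha> =
    ?D (\<lambda>\<omega>. \<beta> * X\<^sub>\<mu> \<omega> + \<alpha>) + ?D (\<lambda>\<omega>. \<gamma> * X\<^sub>\<nu> \<omega>)"
    using law_inv[OF X(1) assms(9)] law_inv[OF Y(1) assms(10)] bdd
      super_linear_expectation_add_const[OF D bounded_rvs_cmult, of X\<^sub>\<mu> \<beta> \<alpha>] by simp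
  \<comment> \<open>The potentials \<open>\<beta> * x + \<alpha>\<close> and
    \<open>\<gamma> * y\<close> satisfy the dual constraint with equality everywhere.\<close>
  also have "ereal \<dots> \<le> dual_value M ?D X\<^sub>\<mu> X\<^sub>\<nu> c"
    unfolding dual_value_def
    using bdd by (intro SUP_upper2[of "(\<lambda>x. \<beta> * x + \<alpha>, \<lambda>y. \<gamma> * y)"])
      (auto simp: dual_pairs_def c intro!: bounded_rvs_add bounded_rvs_cmult bounded_rvs_const)
  finally have "primal_value M ?D \<mu> \<nu> c \<le> dual_value M ?D X\<^sub>\<mu> X\<^sub>\<nu> c" .
  moreover have "dual_value M ?D X\<^sub>\<mu> X\<^sub>\<nu> c \<le> primal_value M ?D \<mu> \<nu> c"
    by (rule weak_duality[OF D]) fact+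
  ultimately show "primal_value M ?D \<mu> \<nu> c = dual_value M ?D X\<^sub>\<mu> X\<^sub>\<nu> c"
    by (rule antisym)
qed

end
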